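(* Let $E=\mathrm{Dend}_2^1$ be the two-dimensional complex dendriform algebra with basis $\{e_1,e_2\}$ and products $e_1\prec e_1=e_1$, $e_1\succ e_2=e_2$, all other products of basis elements under $\prec$ and $\succ$ being zero. There is a type of Rota-Baxter operator of weight $0$ on $E$, which is as follows: $$P_1=\begin{pmatrix}0&a_{12}\\0&0\end{pmatrix},\qquad a_{12}\in\mathbb{C},$$ that is, the linear map with $P_1(e_1)=a_{12}e_2$ and $P_1(e_2)=0$ is a Rota-Baxter operator of weight $0$ on $E$.
   Context: A dendriform algebra over $\mathbb{C}$ is a complex vector space $E$ with bilinear operations $\prec,\succ$ satisfying, for all $u,v,w\in E$: $(u\prec v)\prec w=u\prec(v\prec w)+u\prec(v\succ w)$; $(u\succ v)\prec w=u\succ(v\prec w)$; $u\succ(v\succ w)=(u\prec v)\succ w+(u\succ v)\succ w$. Matrix convention: the matrix $(a_{ij})$ of a linear map $P:E\to E$ is defined by rows, $P(e_1)=a_{11}e_1+a_{12}e_2$ and $P(e_2)=a_{21}e_1+a_{22}e_2$. A Rota-Baxter operator of weight $0$ on $E$ is a linear map $P:E\to E$ such that for all $u,v\in E$: $P(u)\prec P(v)=P(P(u)\prec v+u\prec P(v))$ and $P(u)\succ P(v)=P(P(u)\succ v+u\succ P(v))$. *)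

theory Defs
  imports "HOL-Analysis.Analysis"
begin

locale dendriform_algebra = vector_space scale
  for scale :: "complex \<Rightarrow> 'a::ab_group_add \<Rightarrow> 'a" (infixr "\<cdot>" 75) +
  fixes dprec :: "'a \<Rightarrow> 'a \<Rightarrow> 'a" (infixl "\<lhd>" 70)
    and dsucc :: "'a \<Rightarrow> 'a \<Rightarrow> 'a" (infixl "\<rhd>" 70)
  assumes dprec_linear_left: "Vector_Spaces.linear scale scale (\<lambda>u. u \<lhd> v)"
    and dprec_linear_right: "Vector_Spaces.linear scale scale (\<lambda>v. u \<lhd> v)"
    and dsucc_linear_left: "Vector_Spaces.linear scale scale (\<lambda>u. u \<rhd> v)"
    and dsucc_linear_right: "Vector_Spaces.linear scale scale (\<lambda>v. u \<rhd> v)"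
    and dprec_dprec: "(u \<lhd> v) \<lhd> w = u \<lhd> (v \<lhd> w) + u \<lhd> (v \<rhd> w)"
    and dsucc_dprec: "(u \<rhd> v) \<lhd> w = u \<rhd> (v \<lhd> w)"
    and dsucc_dsucc: "u \<rhd> (v \<rhd> w) = (u \<lhd> v) \<rhd> w + (u \<rhd> v) \<rhd> w"
begin

definition rota_baxter_0 :: "('a \<Rightarrow> 'a) \<Rightarrow> bool" where
  "rota_baxter_0 P \<longleftrightarrow>
     Vector_Spaces.linear scale scale P \<and>
     (\<forall>u v. P u \<lhd> P v = P (P u \<lhd> v + u \<lhd> P v)) \<and>
     (\<forall>u v. P u \<rhd> P v = P (P u \<rhd> v + u \<rhd> P v))"

end

locale Dend21 = dendriform_algebra scale dprec dsucc
  for scale :: "complex \<Rightarrow> 'a::ab_group_add \<Rightarrow> 'a" (infixr "\<cdot>" 75)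
    and dprec :: "'a \<Rightarrow> 'a \<Rightarrow> 'a" (infixl "\<lhd>" 70)
    and dsucc :: "'a \<Rightarrow> 'a \<Rightarrow> 'a" (infixl "\<rhd>" 70) +
  fixes e1 e2 :: 'a
  assumes e1_neq_e2: "e1 \<noteq> e2"
    and independent_basis: "independent {e1, e2}"
    and span_basis: "span {e1, e2} = UNIV"
    and dprec_basis: "e1 \<lhd> e1 = e1" "e1 \<lhd> e2 = 0" "e2 \<lhd> e1 = 0" "e2 \<lhd> e2 = 0"
    and dsucc_basis: "e1 \<rhd> e1 = 0" "e1 \<rhd> e2 = e2" "e2 \<rhd> e1 = 0" "e2 \<rhd> e2 = 0"
begin

text \<open>Row convention: row \<open>i\<close> of \<open>A\<close> holds the coordinates of the image of the
  \<open>i\<close>-th basis vector (the transpose of the convention of the library's matrix operations).\<close>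

definition linear_with_matrix :: "('a \<Rightarrow> 'a) \<Rightarrow> complex^2^2 \<Rightarrow> bool" where
  "linear_with_matrix P A \<longleftrightarrow>
     Vector_Spaces.linear scale scale P \<and>
     P e1 = A $ 1 $ 1 \<cdot> e1 + A $ 1 $ 2 \<cdot> e2 \<and>
     P e2 = A $ 2 $ 1 \<cdot> e1 + A $ 2 $ 2 \<cdot> e2"

end

text \<open>The structure equations of \<open>Dend21\<close> are consistent: it is realised on \<open>\<complex>\<^sup>2\<close>.\<close>

lemma Dend21_complex2:
  "Dend21 (*s)
     (\<lambda>u v. vector [u $ 1 * v $ 1, 0] :: complex^2)
     (\<lambda>u v. vector [0, u $ 1 * v $ 2])
     (vector [1, 0]) (vector [0, 1])"
proof -
  have eq: "x = y \<longleftrightarrow> x $ 1 = y $ 1 \<and> x $ 2 = y $ 2" for x y :: "complex^2"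
    by (simp add: vec_eq_iff forall_2)
  have dec: "x = x $ 1 *s vector [1, 0] + x $ 2 *s vector [0, 1]" for x :: "complex^2"
    by (simp add: eq)
  have span: "vec.span {vector [1, 0], vector [0, 1] :: complex^2} = UNIV"
  proof (intro UNIV_eq_I[symmetric])
    fix x :: "complex^2"
    show "x \<in> vec.span {vector [1, 0], vector [0, 1]}"
      by (subst dec) (intro vec.span_add vec.span_scale vec.span_base; simp)
  qed
  have ind: "vec.independent {vector [1, 0], vector [0, 1] :: complex^2}"
    by (auto simp: vec.independent_insert vec.span_singleton vec.dependent_single eq)
  show ?thesis
    by unfold_locales (simp_all add: eq algebra_simps span ind)
qed

end

theory Submission
  imports Defs
begin

text \<open>In coordinates, \<open>P u\<close> is a multiple of \<open>e2\<close>, and \<open>e2\<close> is annihilated by all products except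
  \<open>u \<rhd> e2\<close>, which is again a multiple of \<open>e2\<close> and hence killed by \<open>P\<close>. So both sides of
  each Rota--Baxter identity vanish.\<close>

context Dend21
begin

text \<open>Provides the library facts on linear maps, here for maps from the space to itself and
  for each product with one argument fixed.\<close>

sublocale endo: vector_space_pair scale scale
  by unfold_locales

lemma coordinates:
  obtains a b where "u = a \<cdot> e1 + b \<cdot> e2"
proof -
  have "u \<in> span {e1, e2}"
    by (simp add: span_basis)
  then obtain a where "u - a \<cdot> e1 \<in> span {e2}"
    by (auto simp: span_insert)
  then obtain b where "u - a \<cdot> e1 = b \<cdot> e2"
    by (auto simp: span_singleton)
  then have "u = a \<cdot> e1 + b \<cdot> e2"
    by (simp add: algebra_simps)
  then show thesis
    by (rule that)
qed

text \<open>A linear map is determined by its values on a basis, and these can be prescribed freely.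
  This justifies speaking of the linear map with a given matrix.\<close>

lemma ex1_linear_with_matrix: "\<exists>!P. linear_with_matrix P A"
proof (rule ex_ex1I)
  \<comment> \<open>Only the values of \<open>?f\<close> at \<open>e1\<close> and \<open>e2\<close>
    matter: \<open>?f\<close> need not be linear, and \<open>e1_neq_e2\<close> ensures that the
    second branch is the one taken at \<open>e2\<close>.\<close>
  let ?f = "\<lambda>x. if x = e1 then A $ 1 $ 1 \<cdot> e1 + A $ 1 $ 2 \<cdot> e2
                 else A $ 2 $ 1 \<cdot> e1 + A $ 2 $ 2 \<cdot> e2"
  obtain P where "Vector_Spaces.linear scale scale P" "\<forall>x\<in>{e1, e2}. P x = ?f x"
    using endo.linear_independent_extend[OF independent_basis, of ?f] by blast
  then show "\<exists>P. linear_with_matrix P A"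
    using e1_neq_e2 by (auto simp: linear_with_matrix_def)
next
  fix P Q
  assume PQ: "linear_with_matrix P A" "linear_with_matrix Q A"
  show "P = Q"
  proof
    fix u
    obtain a b where u: "u = a \<cdot> e1 + b \<cdot> e2"
      by (rule coordinates)
    from PQ have "Vector_Spaces.linear scale scale P" "Vector_Spaces.linear scale scale Q"
      "P e1 = Q e1" "P e2 = Q e2"
      by (simp_all add: linear_with_matrix_def)
    then show "P u = Q u"
      by (simp add: u endo.linear_add endo.linear_scale)
  qed
qed

lemmas bilinear_simps =
  endo.linear_add[OF dprec_linear_left] endo.linear_scale[OF dprec_linear_left]
  endo.linear_add[OF dprec_linear_right] endo.linear_scale[OF dprec_linear_right]
  endo.linear_add[OF dsucc_linear_left] endo.linear_scale[OF dsucc_linear_left]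
  endo.linear_add[OF dsucc_linear_right] endo.linear_scale[OF dsucc_linear_right]

lemma rota_baxter_0_if_nilpotent_matrix:
  assumes "linear_with_matrix P (vector [vector [0, a], vector [0, 0]])"
  shows "rota_baxter_0 P"
proof -
  have lin: "Vector_Spaces.linear scale scale P" and P: "P e1 = a \<cdot> e2" "P e2 = 0"
    using assms by (simp_all add: linear_with_matrix_def)
  \<comment> \<open>These rules reduce both identities to products of basis vectors.
    \<open>endo.linear_0\<close> is needed where all products inside \<open>P\<close> vanish,
    leaving \<open>P 0\<close>.\<close>
  note simps = bilinear_simps dprec_basis dsucc_basis P
    endo.linear_add[OF lin] endo.linear_scale[OF lin] endo.linear_0[OF lin]
  have "P u \<lhd> P v = P (P u \<lhd> v + u \<lhd> P v) \<and> P u \<rhd> P v = P (P u \<rhd> v + u \<rhd> P v)" for u v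
  proof -
    obtain b c where "u = b \<cdot> e1 + c \<cdot> e2"
      by (rule coordinates)
    moreover obtain b' c' where "v = b' \<cdot> e1 + c' \<cdot> e2"
      by (rule coordinates)
    ultimately show ?thesis
      by (simp add: simps)
  qed
  with lin show ?thesis
    by (simp add: rota_baxter_0_def)
qed

end

text \<open>The existence part keeps the universally quantified part from being vacuous.\<close>

theorem theorem2p1:
  fixes scale :: "complex \<Rightarrow> 'a::ab_group_add \<Rightarrow> 'a"
    and dprec dsucc :: "'a \<Rightarrow> 'a \<Rightarrow> 'a"
    and e1 e2 :: 'a
    and a12 :: complex
  assumes "Dend21 scale dprec dsucc e1 e2"
  shows "(\<exists>!P. Dend21.linear_with_matrix scale e1 e2 P (vector [vector [0, a12], vector [0, 0]])) \<and>
         (\<forall>P. Dend21.linear_with_matrix scale e1 e2 P (vector [vector [0, a12], vector [0, 0]]) \<longrightarrow>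
              dendriform_algebra.rota_baxter_0 scale dprec dsucc P)"
proof -
  interpret Dend21 scale dprec dsucc e1 e2
    by (rule assms)
  show ?thesis
    using ex1_linear_with_matrix rota_baxter_0_if_nilpotent_matrix by blast
qed

end
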